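(* Consider the problem of minimizing $f=\sum_{i=1}^m f_i$ over $X$, and suppose that Assumption 1 (common optimal solution) and Assumption 2 (Hölder condition of order $p>0$ with moduli $L_i$) stated in the context hold. Let $\{x_k\}$ be a sequence generated by the incremental subgradient method described in the context with the constant stepsize rule $v_k\equiv v\,(>0)$ for all $k\in\mathbb{N}$. Then $$\liminf_{k\to\infty} f(x_k)\le f^*+\left(\frac{m^2 v}{2C_{p,m}}\right)^p,\qquad\text{where } C_{p,m}:=L_{\max}^{-\frac1p}\min\left\{1,(2m)^{1-\frac1p}\right\}.$$
   Context: Setting. $X\subseteq\mathbb{R}^n$ is nonempty, closed and convex, and $f_1,\dots,f_m:\mathbb{R}^n\to\mathbb{R}$ are continuous and quasi-convex (a function $h$ is quasi-convex if $h((1-\alpha)x+\alpha y)\le\max\{h(x),h(y)\}$ for all $x,y\in\mathbb{R}^n$, $\alpha\in[0,1]$). Put $f:=\sum_{i=1}^m f_i$ ($f$ need not be quasi-convex), $f^*:=\min_{x\in X}f(x)$, $X^*:=\arg\min_{x\in X}f(x)$, $f_i^*:=\min_{x\in X}f_i(x)$, $X_i^*:=\arg\min_{x\in X}f_i(x)$. $\mathbb{N}=\{0,1,2,\dots\}$; $\|\cdot\|$ is the Euclidean norm, $P_X$ the Euclidean projection onto $X$, and $S(0,1)$ the unit sphere. Assumption 1. The component functions have a common optimal solution over $X$ (equivalently $X^*=\bigcap_{i=1}^m X_i^*\neq\emptyset$). Assumption 2. $p>0$, $L_i>0$ for $i=1,\dots,m$, and for each $i$, $|f_i(y)-f_i(x)|\le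 L_i\|y-x\|^p$ for all $x\in X$ and all $y\in\mathbb{R}^n$. Put $L_{\max}:=\max_{i=1,\dots,m}L_i$. Quasi-subdifferential. For quasi-convex $h:\mathbb{R}^n\to\mathbb{R}$ and $x\in\mathbb{R}^n$, $\partial h(x):=\{g:\langle g,y-x\rangle\le 0\text{ for every } y \text{ with } h(y)<h(x)\}$. Incremental subgradient method. Initialize an initial point $x_0\in\mathbb{R}^n$, a stepsize sequence $\{v_k\}$, and $k:=0$. While $f(x_k)>f^*$: set $z_{k,0}:=x_k$; for $i=1,\dots,m$: if $f_i(z_{k,i-1})=f_i^*$, set $z_{k,i}:=z_{k,i-1}$; otherwise calculate $g_{k,i}\in\partial f_i(z_{k,i-1})\cap S(0,1)$ and set $z_{k,i}:=P_X(z_{k,i-1}-v_kg_{k,i})$. Then set $x_{k+1}:=z_{k,m}$ and $k:=k+1$. *)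

theory Defs
  imports "HOL-Analysis.Analysis"
begin

definition quasi_convex :: "('a::real_vector \<Rightarrow> real) \<Rightarrow> bool" where
  "quasi_convex h \<longleftrightarrow>
     (\<forall>x y. \<forall>\<alpha>\<in>{0..1}. h ((1 - \<alpha>) *\<^sub>R x + \<alpha> *\<^sub>R y) \<le> max (h x) (h y))"

definition argmin_set :: "'a set \<Rightarrow> ('a \<Rightarrow> real) \<Rightarrow> 'a set" where
  "argmin_set X h = {x. is_arg_min h (\<lambda>x. x \<in> X) x}"

text \<open>The least element of the image of \<open>X\<close>; a meaningful value only if the minimum is attained,
  i.e. if \<^term>\<open>argmin_set X h \<noteq> {}\<close>.\<close>

definition min_over :: "'a set \<Rightarrow> ('a \<Rightarrow> real) \<Rightarrow> real" where
  "min_over X h = (LEAST r. r \<in> h ` X)"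

definition quasi_subdiff :: "('a::real_inner \<Rightarrow> real) \<Rightarrow> 'a \<Rightarrow> 'a set" where
  "quasi_subdiff h x = {g. \<forall>y. h y < h x \<longrightarrow> g \<bullet> (y - x) \<le> 0}"

definition component_update ::
  "'a::euclidean_space set \<Rightarrow> ('a \<Rightarrow> real) \<Rightarrow> real \<Rightarrow> 'a \<Rightarrow> 'a \<Rightarrow> bool" where
  "component_update X h s z z' \<longleftrightarrow>
     (if h z = min_over X h then z' = z
      else (\<exists>g \<in> quasi_subdiff h z \<inter> sphere 0 1. z' = closest_point X (z - s *\<^sub>R g)))"

definition incremental_cycle ::
  "'a::euclidean_space set \<Rightarrow> nat \<Rightarrow> (nat \<Rightarrow> 'a \<Rightarrow> real) \<Rightarrow> real \<Rightarrow> 'a \<Rightarrow> 'a \<Rightarrow> bool" where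
  "incremental_cycle X m f s x x' \<longleftrightarrow>
     (\<exists>z :: nat \<Rightarrow> 'a. z 0 = x \<and> z m = x' \<and>
        (\<forall>i\<in>{1..m}. component_update X (f i) s (z (i - 1)) (z i)))"

text \<open>The method stops as soon as \<open>f (x k) > f\<^sup>*\<close> fails. A finite run is represented by the infinite
  sequence that repeats its last iterate, so that the relation covers both the runs that
  never stop and those that do. The initial point \<open>x 0\<close> is arbitrary; it need not lie in \<open>X\<close>.\<close>

definition incremental_subgradient_seq ::
  "'a::euclidean_space set \<Rightarrow> nat \<Rightarrow> (nat \<Rightarrow> 'a \<Rightarrow> real) \<Rightarrow> (nat \<Rightarrow> real) \<Rightarrow> (nat \<Rightarrow> 'a) \<Rightarrow> bool" where
  "incremental_subgradient_seq X m f v x \<longleftrightarrow>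
     (\<forall>k. if (\<Sum>i=1..m. f i (x k)) > min_over X (\<lambda>y. \<Sum>i=1..m. f i y)
          then incremental_cycle X m f (v k) (x k) (x (Suc k))
          else x (Suc k) = x k)"

definition C_const :: "(nat \<Rightarrow> real) \<Rightarrow> real \<Rightarrow> nat \<Rightarrow> real" where
  "C_const L p m =
     Max (L ` {1..m}) powr (- 1 / p) * min 1 ((2 * real m) powr (1 - 1 / p))"

end

theory Submission
  imports Defs
begin

text \<open>
  Let \<open>a\<close> be a common minimiser, \<open>f\<^sup>* = f a\<close>, and let \<open>M\<close> be the largest of the moduli.
  The proof is a Fejer-type argument: if the limit inferior exceeded the asserted bound, then \<open>f (x k)\<close>
  would eventually stay above it by a fixed margin, and from then on the squared distance of
  \<open>x k\<close> to \<open>a\<close> would drop in each cycle by at least a fixed positive amount, which cannot go on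
  for ever.

  Three ideas produce the drop. First, a quasi-subgradient at \<open>z\<close> is by itself only a direction,
  but the Hoelder condition makes the sublevel set of \<open>f i\<close> below \<open>f i z\<close> contain the open ball about
  \<open>a\<close> of radius \<open>((f i z - f i a) / M) powr (1 / p)\<close>. A unit normal \<open>g\<close> to that sublevel set
  therefore satisfies \<open>g \<bullet> (z - a) \<ge> ((f i z - f i a) / M) powr (1 / p)\<close>
  (lemma \<open>quasi_subgradient_inner_ge\<close>). This quantity enters the expansion of
  \<open>(norm (z - v *\<^sub>R g - a))\<^sup>2\<close> with the factor \<open>- 2 * v\<close>, and projecting onto \<open>X\<close> brings
  the point no further from \<open>a \<in> X\<close> (lemma \<open>component_update_descent\<close>).

  Second, within one cycle the inner iterates move by at most \<open>v\<close> each, so the Hoelder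
  condition also compares \<open>f i\<close> at the inner iterate \<open>z (i - 1)\<close> with \<open>f i\<close> at the starting
  point of the cycle; the discrepancy is at most \<open>M * ((i - 1) * v) powr p\<close>.

  Third, the \<open>m\<close> gaps \<open>f i (z (i - 1)) - f i a\<close> and the \<open>m\<close> discrepancies together dominate
  \<open>f x - f a\<close>, and a power-mean inequality for these \<open>2 * m\<close> numbers
  (lemma \<open>powr_sum_le_sum_powr\<close>) passes from the power \<open>1 / p\<close> of a sum to the sum of the powers.
  That is the origin of the factor \<open>min 1 ((2 * m) powr (1 - 1 / p))\<close>. After division
  by \<open>M\<close>, the discrepancy bounds have the powers \<open>(i - 1) * v\<close>, with sum \<open>v * m * (m - 1) / 2\<close>. Together with the
  \<open>m\<close> terms \<open>v\<^sup>2\<close> from the squares this gives the error \<open>m\<^sup>2 * v\<^sup>2\<close> per cycle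
  (lemma \<open>incremental_cycle_descent\<close>), which the gain exceeds as long as \<open>f (x k)\<close> stays
  above the asserted bound by a fixed margin.
\<close>

section \<open>A power-mean inequality\<close>

text \<open>For \<open>q \<le> 1\<close> this is subadditivity of \<open>t powr q\<close>: after dividing by the sum, every term is
  in \<open>{0..1}\<close> and hence at most its power. For \<open>q \<ge> 1\<close> it is Jensen's inequality for \<open>t powr q\<close>.\<close>

lemma powr_sum_le_sum_powr:
  fixes b :: "'i \<Rightarrow> real"
  assumes "finite J" "\<And>j. j \<in> J \<Longrightarrow> b j \<ge> 0" "q > 0"
  shows "min 1 (real (card J) powr (1 - q)) * (\<Sum>j\<in>J. b j) powr q \<le> (\<Sum>j\<in>J. b j powr q)"
proof (cases "(\<Sum>j\<in>J. b j) = 0")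
  case True
  then show ?thesis by (simp add: sum_nonneg)
next
  case False
  define S where "S = (\<Sum>j\<in>J. b j)"
  have S: "S > 0"
    using False assms(2) sum_nonneg[of J b] unfolding S_def by fastforce
  show ?thesis
  proof (cases "q \<le> 1")
    case True
    have "b j / S \<le> (b j / S) powr q" if "j \<in> J" for j
    proof -
      have "b j \<le> S" unfolding S_def using assms that by (intro member_le_sum) auto
      then have "b j / S \<le> 1" "b j / S \<ge> 0" using S assms(2)[OF that] by auto
      then have "(b j / S) powr 1 \<le> (b j / S) powr q" using True by (intro powr_mono') auto
      then show ?thesis unfolding powr_one[OF \<open>b j / S \<ge> 0\<close>] .
    qed
    then have "(\<Sum>j\<in>J. b j / S) \<le> (\<Sum>j\<in>J. (b j / S) powr q)"
      by (rule sum_mono)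
    moreover have "(\<Sum>j\<in>J. b j / S) = 1"
      using S by (simp add: S_def flip: sum_divide_distrib)
    moreover have "(\<Sum>j\<in>J. (b j / S) powr q) = (\<Sum>j\<in>J. b j powr q) / S powr q"
      using assms(2) S by (simp add: powr_divide sum_divide_distrib)
    ultimately have "S powr q \<le> (\<Sum>j\<in>J. b j powr q)"
      using S by (simp add: field_simps)
    moreover have "min 1 (real (card J) powr (1 - q)) * S powr q \<le> S powr q"
      using mult_right_mono[of "min 1 (real (card J) powr (1 - q))" 1 "S powr q"] by simp
    ultimately show ?thesis by (simp add: S_def)
  next
    case q: False
    \<comment> \<open>Discarding the zero terms makes Jensen's inequality on \<open>{0<..}\<close> applicable and only
      improves the constant.\<close>
    define K where "K = {j \<in> J. b j > 0}"
    have K: "finite K" "K \<subseteq> J" using assms(1) by (auto simp: K_def)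
    have SK: "S = (\<Sum>j\<in>K. b j)"
      unfolding S_def K_def using assms by (intro sum.mono_neutral_right) force+
    have Kne: "K \<noteq> {}" using SK S by auto
    then have n: "real (card K) > 0" using K by (simp add: card_gt_0_iff)
    have "(\<Sum>j\<in>K. (1 / real (card K)) *\<^sub>R b j) powr q
            \<le> (\<Sum>j\<in>K. (1 / real (card K)) * b j powr q)"
      using n q K Kne by (intro convex_on_sum[OF _ _ powr_convex]) (auto simp: K_def)
    then have "(S / real (card K)) powr q \<le> (\<Sum>j\<in>K. b j powr q) / real (card K)"
      by (simp add: SK sum_divide_distrib)
    then have "real (card K) powr (1 - q) * S powr q \<le> (\<Sum>j\<in>K. b j powr q)"
      using n S by (simp add: powr_divide powr_diff field_simps)
    moreover have "real (card J) powr (1 - q) \<le> real (card K) powr (1 - q)"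
      using n q K card_mono[OF assms(1) K(2)] by (intro powr_mono2') auto
    then have "min 1 (real (card J) powr (1 - q)) * S powr q \<le> real (card K) powr (1 - q) * S powr q"
      by (intro mult_right_mono) auto
    moreover have "(\<Sum>j\<in>K. b j powr q) \<le> (\<Sum>j\<in>J. b j powr q)"
      using K assms(1) by (intro sum_mono2) auto
    ultimately show ?thesis by (simp add: S_def)
  qed
qed

section \<open>A single component step\<close>

lemma min_over_eq:
  assumes "a \<in> argmin_set X h"
  shows "min_over X h = h a"
  using assms unfolding min_over_def argmin_set_def is_arg_min_linorder
  by (intro Least_equality) auto

text \<open>Every \<open>a + t *\<^sub>R g\<close> with \<open>t\<close> below the right-hand radius has value less than \<open>h z\<close> by the
  growth condition, so the defining inequality of \<open>g\<close> applies to it and gives \<open>t \<le> g \<bullet> (z - a)\<close>.\<close>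

lemma quasi_subgradient_inner_ge:
  fixes h :: "'a::real_inner \<Rightarrow> real"
  assumes g: "g \<in> quasi_subdiff h z" "norm g = 1"
    and growth: "\<And>y. h y - h a \<le> M * norm (y - a) powr p"
    and "p > 0" "M > 0" "h a < h z"
  shows "((h z - h a) / M) powr (1 / p) \<le> g \<bullet> (z - a)"
proof -
  define r where "r = ((h z - h a) / M) powr (1 / p)"
  have r: "r > 0" "M * r powr p = h z - h a"
    using assms by (auto simp: r_def powr_powr)
  have "t \<le> g \<bullet> (z - a)" if t: "0 < t" "t < r" for t
  proof -
    have "h (a + t *\<^sub>R g) - h a \<le> M * t powr p"
      using growth[of "a + t *\<^sub>R g"] g t by simp
    also have "\<dots> < M * r powr p"
      using assms t by (intro mult_strict_left_mono powr_less_mono2) auto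
    finally have "h (a + t *\<^sub>R g) < h z" using r by simp
    then have "g \<bullet> (a + t *\<^sub>R g - z) \<le> 0" using g by (auto simp: quasi_subdiff_def)
    moreover have "g \<bullet> g = 1" using g by (simp add: dot_square_norm)
    ultimately show ?thesis by (simp add: inner_simps)
  qed
  then show ?thesis
    using r dense_le_bounded[of 0 r "g \<bullet> (z - a)"] by (simp flip: r_def)
qed

lemma component_update_in:
  assumes "closed X" "X \<noteq> {}" "component_update X h s z z'"
  shows "z' \<in> X \<or> z' = z \<and> h z = min_over X h"
  using assms closest_point_in_set by (auto simp: component_update_def split: if_splits)

lemma component_update_norm_le:
  assumes "closed X" "convex X" "z \<in> X" "s \<ge> 0" "component_update X h s z z'"
  shows "norm (z' - z) \<le> s"
proof (cases "h z = min_over X h")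
  case True
  then show ?thesis using assms by (simp add: component_update_def)
next
  case False
  then obtain g where g: "norm g = 1" "z' = closest_point X (z - s *\<^sub>R g)"
    using assms by (auto simp: component_update_def)
  have "dist (closest_point X (z - s *\<^sub>R g)) (closest_point X z) \<le> dist (z - s *\<^sub>R g) z"
    using assms by (intro closest_point_lipschitz) auto
  then show ?thesis
    using assms g by (simp add: closest_point_self dist_norm)
qed

text \<open>The projection is nonexpansive and fixes the minimiser \<open>a\<close>, so it suffices to expand the
  square before projecting and to bound the inner product below.\<close>

lemma component_update_descent:
  fixes X :: "'a::euclidean_space set"
  assumes X: "closed X" "convex X" and a: "a \<in> argmin_set X h" and z: "z \<in> X"
    and growth: "\<And>y. h y - h a \<le> M * norm (y - a) powr p"
    and "p > 0" "M > 0" "s \<ge> 0" and upd: "component_update X h s z z'"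
  shows "(norm (z' - a))\<^sup>2 \<le> (norm (z - a))\<^sup>2 - 2 * s * ((h z - h a) / M) powr (1 / p) + s\<^sup>2"
proof (cases "h z = h a")
  case True
  then have "z' = z"
    using upd by (simp add: component_update_def min_over_eq[OF a])
  then show ?thesis using True by simp
next
  case False
  have aX: "a \<in> X" and "h a \<le> h z"
    using a z by (auto simp: argmin_set_def is_arg_min_linorder)
  then have less: "h a < h z" using False by simp
  obtain g where g: "g \<in> quasi_subdiff h z" "norm g = 1" "z' = closest_point X (z - s *\<^sub>R g)"
    using upd False by (auto simp: component_update_def min_over_eq[OF a])
  have "dist z' (closest_point X a) \<le> dist (z - s *\<^sub>R g) a"
    using X aX unfolding g(3) by (intro closest_point_lipschitz) auto
  then have "norm (z' - a) \<le> norm ((z - a) - s *\<^sub>R g)"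
    using aX by (simp add: closest_point_self dist_norm algebra_simps)
  then have "(norm (z' - a))\<^sup>2 \<le> (norm ((z - a) - s *\<^sub>R g))\<^sup>2"
    by (simp add: power_mono)
  also have "\<dots> = (norm (z - a))\<^sup>2 - 2 * s * (g \<bullet> (z - a)) + s\<^sup>2"
  proof -
    have "g \<bullet> g = 1" using g by (simp add: dot_square_norm)
    then show ?thesis
      unfolding power2_norm_eq_inner by (simp add: inner_simps inner_commute power2_eq_square algebra_simps)
  qed
  also have "\<dots> \<le> (norm (z - a))\<^sup>2 - 2 * s * ((h z - h a) / M) powr (1 / p) + s\<^sup>2"
    using quasi_subgradient_inner_ge[OF g(1,2) growth] assms less
    by (simp add: mult_left_mono)
  finally show ?thesis .
qed

section \<open>A full cycle\<close>

text \<open>The starting point may lie outside \<open>X\<close>. Inner steps leave it in place until the first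
  component whose value there differs from its minimum over \<open>X\<close>; that step projects onto \<open>X\<close>,
  and later ones do not leave \<open>X\<close>.\<close>

lemma incremental_cycle_in:
  assumes "closed X" "X \<noteq> {}" and cyc: "incremental_cycle X m f s x x'"
  shows "x' \<in> X \<or> (\<forall>i\<in>{1..m}. f i x = min_over X (f i))"
proof -
  obtain z where z: "z 0 = x" "z m = x'"
    and upd: "\<And>i. i \<in> {1..m} \<Longrightarrow> component_update X (f i) s (z (i - 1)) (z i)"
    using cyc unfolding incremental_cycle_def by blast
  have "j \<le> m \<Longrightarrow> z j \<in> X \<or> z j = x \<and> (\<forall>i\<in>{1..j}. f i x = min_over X (f i))" for j
  proof (induction j)
    case (Suc j)
    have "z (Suc j) \<in> X \<or> z (Suc j) = z j \<and> f (Suc j) (z j) = min_over X (f (Suc j))"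
      using component_update_in[OF assms(1,2) upd[of "Suc j"]] Suc.prems by simp
    then show ?case
      using Suc by (auto simp: le_Suc_eq)
  qed (simp add: z)
  from this[of m] show ?thesis using z by auto
qed

text \<open>The sum of the component steps. The constant is the one of the power-mean inequality for
  \<open>2 * m\<close> terms, and \<open>m\<^sup>2 = m * (m - 1) + m\<close> collects the discrepancies between the inner iterates
  and \<open>x\<close>, and the squares of the \<open>m\<close> steps.\<close>

lemma incremental_cycle_descent:
  fixes X :: "'a::euclidean_space set"
  assumes X: "closed X" "convex X" and x: "x \<in> X"
    and a: "\<And>i. i \<in> {1..m} \<Longrightarrow> a \<in> argmin_set X (f i)"
    and hoelder: "\<And>i u y. i \<in> {1..m} \<Longrightarrow> u \<in> X \<Longrightarrow> \<bar>f i y - f i u\<bar> \<le> M * norm (y - u) powr p"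
    and p: "p > 0" and M: "M > 0" and v: "v \<ge> 0"
    and cyc: "incremental_cycle X m f v x x'"
  shows "(norm (x' - a))\<^sup>2 \<le> (norm (x - a))\<^sup>2
           - 2 * v * (min 1 ((2 * real m) powr (1 - 1 / p))
                * ((\<Sum>i=1..m. f i x - f i a) / M) powr (1 / p))
           + (real m)\<^sup>2 * v\<^sup>2"
proof -
  obtain z where z: "z 0 = x" "z m = x'"
    and upd: "\<And>i. i \<in> {1..m} \<Longrightarrow> component_update X (f i) v (z (i - 1)) (z i)"
    using cyc unfolding incremental_cycle_def by blast
  define A where "A = (\<lambda>i. (f i (z (i - 1)) - f i a) / M)"
  define D where "D = min 1 ((2 * real m) powr (1 - 1 / p))"
  have zX: "z j \<in> X" if "j \<le> m" for j
    using that
  proof (induction j)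
    case (Suc j)
    then show ?case
      using component_update_in[OF X(1) _ upd[of "Suc j"]] by force
  qed (simp add: z x)
  have aX: "a \<in> X" if "i \<in> {1..m}" for i
    using a[OF that] by (auto simp: argmin_set_def is_arg_min_linorder)
  have A_nonneg: "A i \<ge> 0" if "i \<in> {1..m}" for i
    using a[OF that] zX[of "i - 1"] that M
    by (auto simp: A_def argmin_set_def is_arg_min_linorder)
  have drift: "norm (z j - x) \<le> real j * v" if "j \<le> m" for j
    using that
  proof (induction j)
    case (Suc j)
    have "norm (z (Suc j) - z j) \<le> v"
      using component_update_norm_le[OF X zX v upd[of "Suc j"]] Suc.prems by simp
    moreover have "norm (z (Suc j) - x) \<le> norm (z (Suc j) - z j) + norm (z j - x)"
      using norm_triangle_ineq[of "z (Suc j) - z j" "z j - x"] by simp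
    ultimately show ?case using Suc by (simp add: algebra_simps)
  qed (simp add: z)
  have "(norm (z j - a))\<^sup>2 \<le> (norm (x - a))\<^sup>2
      - 2 * v * (\<Sum>i=1..j. A i powr (1 / p)) + real j * v\<^sup>2" if "j \<le> m" for j
    using that
  proof (induction j)
    case (Suc j)
    then have i: "Suc j \<in> {1..m}" by simp
    have "f (Suc j) y - f (Suc j) a \<le> M * norm (y - a) powr p" for y
      using hoelder[OF i aX[OF i], of y] by simp
    from component_update_descent[OF X a[OF i] zX this p M v upd[OF i]]
    have "(norm (z (Suc j) - a))\<^sup>2
        \<le> (norm (z j - a))\<^sup>2 - 2 * v * A (Suc j) powr (1 / p) + v\<^sup>2"
      using i by (simp add: A_def)
    then show ?case using Suc by (simp add: algebra_simps)
  qed (simp add: z)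
  from this[of m] have total: "(norm (x' - a))\<^sup>2 \<le> (norm (x - a))\<^sup>2
      - 2 * v * (\<Sum>i=1..m. A i powr (1 / p)) + real m * v\<^sup>2"
    by (simp add: z)
  have gap: "(f i x - f i a) / M \<le> A i + (real (i - 1) * v) powr p" if i: "i \<in> {1..m}" for i
  proof -
    have "f i x - f i (z (i - 1)) \<le> M * norm (x - z (i - 1)) powr p"
      using hoelder[OF i zX[of "i - 1"], of x] i by force
    also have "\<dots> \<le> M * (real (i - 1) * v) powr p"
      using drift[of "i - 1"] i M p
      by (intro mult_left_mono powr_mono2) (auto simp: norm_minus_commute)
    finally show ?thesis using M by (simp add: A_def field_simps)
  qed
  have gap_nonneg: "f i x - f i a \<ge> 0" if "i \<in> {1..m}" for i
    using a[OF that] x by (auto simp: argmin_set_def is_arg_min_linorder)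
  define b where "b = case_sum A (\<lambda>i. (real (i - 1) * v) powr p)"
  define J where "J = {1..m} <+> {1..m}"
  have sum_b: "(\<Sum>j\<in>J. b j) = (\<Sum>i=1..m. A i + (real (i - 1) * v) powr p)"
    by (simp add: J_def b_def sum.Plus sum.distrib)
  have "(\<Sum>i=1..m. f i x - f i a) / M \<le> (\<Sum>j\<in>J. b j)"
    unfolding sum_b sum_divide_distrib using gap by (intro sum_mono) auto
  moreover have "(\<Sum>i=1..m. f i x - f i a) / M \<ge> 0"
    using gap_nonneg M by (intro divide_nonneg_pos sum_nonneg) auto
  ultimately have "D * ((\<Sum>i=1..m. f i x - f i a) / M) powr (1 / p)
      \<le> D * (\<Sum>j\<in>J. b j) powr (1 / p)"
    using p by (intro mult_left_mono powr_mono2) (auto simp: D_def)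
  also have "\<dots> \<le> (\<Sum>j\<in>J. b j powr (1 / p))"
  proof -
    have "card J = 2 * m" "finite J" by (auto simp: J_def card_Plus)
    moreover have "b j \<ge> 0" if "j \<in> J" for j
      using that A_nonneg by (auto simp: J_def b_def)
    ultimately show ?thesis
      using powr_sum_le_sum_powr[of J b "1 / p"] p by (simp add: D_def)
  qed
  also have "\<dots> = (\<Sum>i=1..m. A i powr (1 / p)) + (\<Sum>i=1..m. real (i - 1) * v)"
    using p v by (simp add: J_def b_def sum.Plus powr_powr)
  also have "(\<Sum>i=1..m. real (i - 1) * v) = v * (real m * (real m - 1) / 2)"
    by (induction m) (auto simp: field_simps)
  finally have "2 * v * (D * ((\<Sum>i=1..m. f i x - f i a) / M) powr (1 / p))
      \<le> 2 * v * ((\<Sum>i=1..m. A i powr (1 / p)) + v * (real m * (real m - 1) / 2))"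
    using v by (intro mult_left_mono) auto
  moreover have "2 * v * ((\<Sum>i=1..m. A i powr (1 / p)) + v * (real m * (real m - 1) / 2))
      = 2 * v * (\<Sum>i=1..m. A i powr (1 / p)) + (real m)\<^sup>2 * v\<^sup>2 - real m * v\<^sup>2"
    by (simp add: field_simps power2_eq_square)
  ultimately show ?thesis
    using total unfolding D_def by linarith
qed

section \<open>The limit inferior\<close>

lemma not_eventually_decreasing_by:
  fixes d :: "nat \<Rightarrow> real"
  assumes "\<delta> > 0" "\<And>k. k \<ge> N \<Longrightarrow> d (Suc k) \<le> d k - \<delta>" "\<And>k. d k \<ge> 0"
  shows False
proof -
  have bound: "d (N + j) \<le> d N - real j * \<delta>" for j
  proof (induction j)
    case (Suc j)
    then show ?case using assms(2)[of "N + j"] by (simp add: algebra_simps)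
  qed simp
  obtain j where "d N < real j * \<delta>"
    using reals_Archimedean3[OF assms(1)] by blast
  then show False using bound[of j] assms(3)[of "N + j"] by linarith
qed

theorem theorem3p1:
  fixes X :: "(real ^ 'n) set"
    and m :: nat
    and f :: "nat \<Rightarrow> real ^ 'n \<Rightarrow> real"
    and L :: "nat \<Rightarrow> real"
    and p v :: real
    and x :: "nat \<Rightarrow> real ^ 'n"
  assumes "X \<noteq> {}" and "closed X" and "convex X"
    and "m \<ge> 1"
    and "\<And>i. i \<in> {1..m} \<Longrightarrow> continuous_on UNIV (f i)"
    and "\<And>i. i \<in> {1..m} \<Longrightarrow> quasi_convex (f i)"
    and common_solution: "(\<Inter>i\<in>{1..m}. argmin_set X (f i)) \<noteq> {}"
    and "p > 0"
    and "\<And>i. i \<in> {1..m} \<Longrightarrow> L i > 0"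
    and hoelder: "\<And>i x y. i \<in> {1..m} \<Longrightarrow> x \<in> X \<Longrightarrow>
                    \<bar>f i y - f i x\<bar> \<le> L i * norm (y - x) powr p"
    and "v > 0"
    and "incremental_subgradient_seq X m f (\<lambda>_. v) x"
  shows "liminf (\<lambda>k. ereal (\<Sum>i=1..m. f i (x k)))
           \<le> ereal (min_over X (\<lambda>y. \<Sum>i=1..m. f i y)
                     + ((real m)\<^sup>2 * v / (2 * C_const L p m)) powr p)"
proof (rule ccontr)
  define F where "F = (\<lambda>y. \<Sum>i=1..m. f i y)"
  define M where "M = Max (L ` {1..m})"
  define D where "D = min 1 ((2 * real m) powr (1 - 1 / p))"
  define B where "B = (real m)\<^sup>2 * v / (2 * C_const L p m)"
  obtain a where a: "\<And>i. i \<in> {1..m} \<Longrightarrow> a \<in> argmin_set X (f i)"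
    using common_solution by blast
  have aX: "a \<in> X" and a_le: "\<And>i y. i \<in> {1..m} \<Longrightarrow> y \<in> X \<Longrightarrow> f i a \<le> f i y"
    using a \<open>m \<ge> 1\<close> by (fastforce simp: argmin_set_def is_arg_min_linorder)+
  have "a \<in> argmin_set X F"
    using aX a_le by (auto simp: argmin_set_def is_arg_min_linorder F_def intro!: sum_mono)
  then have min_F: "min_over X F = F a" by (rule min_over_eq)
  have L_le: "L i \<le> M" if "i \<in> {1..m}" for i
    using that by (simp add: M_def)
  have M: "M > 0"
    using L_le[of 1] \<open>m \<ge> 1\<close> assms(9)[of 1] by simp
  have hoelder_M: "\<bar>f i y - f i u\<bar> \<le> M * norm (y - u) powr p" if "i \<in> {1..m}" "u \<in> X" for i u y
    using hoelder[OF that, of y] mult_right_mono[OF L_le[OF that(1)], of "norm (y - u) powr p"]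
    by simp
  have D: "D > 0" using \<open>m \<ge> 1\<close> by (simp add: D_def)
  have C: "C_const L p m = D / M powr (1 / p)"
    by (simp add: C_const_def D_def M_def powr_minus_divide)
  have B: "B \<ge> 0"
    using D \<open>v > 0\<close> by (simp add: B_def C)
  assume "\<not> ?thesis"
  then have "ereal (F a + B powr p) < liminf (\<lambda>k. ereal (F (x k)))"
    using min_F by (simp add: F_def B_def)
  then obtain c where c: "F a + B powr p < c" "ereal c < liminf (\<lambda>k. ereal (F (x k)))"
    using ereal_dense2 by fastforce
  from less_LiminfD[OF c(2)] obtain N where N: "\<And>k. k \<ge> N \<Longrightarrow> F (x k) > c"
    by (auto simp: eventually_sequentially)
  have ca: "B powr p < c - F a" using c by simp
  then have gt: "F (x k) > F a" if "k \<ge> N" for k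
    using N[OF that] powr_ge_zero[of B p] by linarith
  have cycle: "incremental_cycle X m f v (x k) (x (Suc k))" if "k \<ge> N" for k
    using assms(12) gt[OF that] min_F
    unfolding incremental_subgradient_seq_def F_def by metis
  \<comment> \<open>The starting point may lie outside \<open>X\<close>, but every iterate obtained from a cycle is in \<open>X\<close>.\<close>
  have in_X: "x (Suc k) \<in> X" if "k \<ge> N" for k
  proof -
    have "\<not> (\<forall>i\<in>{1..m}. f i (x k) = min_over X (f i))"
    proof
      assume "\<forall>i\<in>{1..m}. f i (x k) = min_over X (f i)"
      then have "F (x k) = F a"
        unfolding F_def using min_over_eq[OF a] by (intro sum.cong) auto
      then show False using gt[OF that] by simp
    qed
    then show ?thesis
      using incremental_cycle_in[OF assms(2,1) cycle[OF that]] by blast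
  qed
  define \<delta> where "\<delta> = 2 * v * (D * ((c - F a) / M) powr (1 / p)) - (real m)\<^sup>2 * v\<^sup>2"
  have "\<delta> > 0"
  proof -
    have "B = (B powr p) powr (1 / p)"
      using B \<open>p > 0\<close> by (simp add: powr_powr)
    also have "\<dots> < (c - F a) powr (1 / p)"
      using ca \<open>p > 0\<close> by (intro powr_less_mono2) auto
    finally have "2 * v * (D * (B / M powr (1 / p))) < 2 * v * (D * ((c - F a) / M) powr (1 / p))"
      using D M \<open>v > 0\<close> ca powr_ge_zero[of B p]
      by (simp add: powr_divide divide_strict_right_mono)
    moreover have "2 * v * (D * (B / M powr (1 / p))) = (real m)\<^sup>2 * v\<^sup>2"
      using D M by (simp add: B_def C field_simps power2_eq_square)
    ultimately show ?thesis by (simp add: \<delta>_def)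
  qed
  moreover have "(norm (x (Suc k) - a))\<^sup>2 \<le> (norm (x k - a))\<^sup>2 - \<delta>" if "k \<ge> Suc N" for k
  proof -
    have "x k \<in> X" using in_X[of "k - 1"] that by (cases k) auto
    moreover have "incremental_cycle X m f v (x k) (x (Suc k))" using cycle that by simp
    ultimately have "(norm (x (Suc k) - a))\<^sup>2 \<le> (norm (x k - a))\<^sup>2
        - 2 * v * (D * ((F (x k) - F a) / M) powr (1 / p)) + (real m)\<^sup>2 * v\<^sup>2"
      using incremental_cycle_descent[OF assms(2,3) _ a hoelder_M \<open>p > 0\<close> M, where v = v and x = "x k" and x' = "x (Suc k)"]
        \<open>v > 0\<close> by (simp add: D_def F_def sum_subtractf)
    moreover have "F a \<le> c" using ca powr_ge_zero[of B p] by linarith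
    then have "2 * v * (D * ((c - F a) / M) powr (1 / p))
        \<le> 2 * v * (D * ((F (x k) - F a) / M) powr (1 / p))"
      using N[of k] that D M \<open>v > 0\<close> \<open>p > 0\<close>
      by (intro mult_left_mono powr_mono2 divide_right_mono divide_nonneg_pos) auto
    ultimately show ?thesis by (simp add: \<delta>_def)
  qed
  ultimately show False
    by (rule not_eventually_decreasing_by[where d = "\<lambda>k. (norm (x k - a))\<^sup>2" and N = "Suc N"]) auto
qed

end
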